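(* Let $G$ be a graph on $n \geq 4$ vertices that is not bipartite. For $0 \leq \alpha < 1$, $\gamma_\alpha(G) \leq \gamma_\alpha(S_n + e)$, with equality if and only if $G \cong S_n + e$.
   Context: All graphs are finite, simple and undirected. For a graph $G$, $A(G)$ is its adjacency matrix and $D(G)$ the diagonal matrix of vertex degrees. For $\alpha\in[0,1]$, $A_\alpha(G) = \alpha D(G) + (1-\alpha)A(G)$, $\rho_\alpha(G)$ is the largest eigenvalue of $A_\alpha(G)$, and $\gamma_\alpha(G) = \Delta(G) - \rho_\alpha(G)$ where $\Delta(G)$ is the maximum degree of $G$. For $n\ge 3$, $S_n + e$ is the graph obtained from the star $S_n$ on $n$ vertices by adding an edge joining two of its vertices of degree one. *)

theory Defs
  imports
    "Graph_Theory.Pair_Digraph"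
    "Graph_Theory.Digraph_Isomorphism"
    "Jordan_Normal_Form.Spectral_Radius"
begin

text \<open>
  A finite simple undirected graph is a \<open>pair_graph\<close>: a finite, symmetric, loop-free set of
  ordered pairs, the edge \<open>uv\<close> being represented by the two arcs \<open>(u, v)\<close> and \<open>(v, u)\<close>.
  Hence the degree of a vertex is its \<open>out_degree\<close>.
\<close>

definition max_degree :: "'a pair_pre_digraph \<Rightarrow> nat" where
  "max_degree G = Max (out_degree (with_proj G) ` pverts G)"

definition bipartite :: "'a pair_pre_digraph \<Rightarrow> bool" where
  "bipartite G \<longleftrightarrow> (\<exists>X Y. X \<union> Y = pverts G \<and> X \<inter> Y = {} \<and>
     (\<forall>(u, v) \<in> parcs G. (u \<in> X \<and> v \<in> Y) \<or> (u \<in> Y \<and> v \<in> X)))"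

text \<open>
  The matrices of a graph are taken with respect to an enumeration \<open>vs\<close> of its vertices;
  the spectrum does not depend on it (lemma \<open>spectrum_A_alpha_enumeration\<close> below).
\<close>

definition adjacency_matrix :: "'a list \<Rightarrow> 'a pair_pre_digraph \<Rightarrow> real mat" where
  "adjacency_matrix vs G =
     mat (length vs) (length vs) (\<lambda>(i, j). if (vs ! i, vs ! j) \<in> parcs G then 1 else 0)"

definition degree_matrix :: "'a list \<Rightarrow> 'a pair_pre_digraph \<Rightarrow> real mat" where
  "degree_matrix vs G =
     mat (length vs) (length vs)
       (\<lambda>(i, j). if i = j then real (out_degree (with_proj G) (vs ! i)) else 0)"

definition A_alpha :: "real \<Rightarrow> 'a list \<Rightarrow> 'a pair_pre_digraph \<Rightarrow> real mat" where
  "A_alpha \<alpha> vs G = \<alpha> \<cdot>\<^sub>m degree_matrix vs G + (1 - \<alpha>) \<cdot>\<^sub>m adjacency_matrix vs G"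

definition vertex_list :: "'a pair_pre_digraph \<Rightarrow> 'a list" where
  "vertex_list G = (SOME vs. distinct vs \<and> set vs = pverts G)"

text \<open>
  The matrix is real and symmetric, so all its eigenvalues are real and the maximum may be taken
  over the spectrum over the reals.
\<close>

definition rho :: "real \<Rightarrow> 'a pair_pre_digraph \<Rightarrow> real" where
  "rho \<alpha> G = Max (spectrum (A_alpha \<alpha> (vertex_list G) G))"

definition gamma :: "real \<Rightarrow> 'a pair_pre_digraph \<Rightarrow> real" where
  "gamma \<alpha> G = real (max_degree G) - rho \<alpha> G"

definition star :: "nat \<Rightarrow> nat pair_pre_digraph" where
  "star n = \<lparr>pverts = {0..<n}, parcs = {0} \<times> {1..<n} \<union> {1..<n} \<times> {0}\<rparr>"

text \<open>For \<open>n \<ge> 3\<close> the vertices 1 and 2 are two leaves of \<open>star n\<close>.\<close>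

definition star_plus_edge :: "nat \<Rightarrow> nat pair_pre_digraph" where
  "star_plus_edge n =
     \<lparr>pverts = pverts (star n), parcs = parcs (star n) \<union> {(1, 2), (2, 1)}\<rparr>"


lemma vertex_list:
  assumes "pair_graph G"
  shows "distinct (vertex_list G)" and "set (vertex_list G) = pverts G"
proof -
  interpret pair_graph G by fact
  have "\<exists>vs. distinct vs \<and> set vs = pverts G"
    using finite_distinct_list[OF pair_finite_verts] by blast
  from someI_ex[OF this] show "distinct (vertex_list G)" "set (vertex_list G) = pverts G"
    by (simp_all add: vertex_list_def)
qed

lemma eigenvalue_A_alpha_iff:
  assumes "distinct vs"
  shows "eigenvalue (A_alpha \<alpha> vs G) k \<longleftrightarrow>
    (\<exists>x. (\<exists>v\<in>set vs. x v \<noteq> 0) \<and>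
      (\<forall>u\<in>set vs. \<alpha> * real (out_degree (with_proj G) u) * x u +
         (1 - \<alpha>) * (\<Sum>v\<in>set vs. if (u, v) \<in> parcs G then x v else 0) = k * x u))"
    (is "_ \<longleftrightarrow> (\<exists>x. ?P x)")
proof -
  let ?n = "length vs"
  have dim [simp]: "dim_row (A_alpha \<alpha> vs G) = ?n" "dim_col (A_alpha \<alpha> vs G) = ?n"
    by (simp_all add: A_alpha_def degree_matrix_def adjacency_matrix_def)
  have row: "(A_alpha \<alpha> vs G *\<^sub>v w) $ i =
      \<alpha> * real (out_degree (with_proj G) (vs ! i)) * x (vs ! i) +
      (1 - \<alpha>) * (\<Sum>v\<in>set vs. if (vs ! i, v) \<in> parcs G then x v else 0)"
    if i: "i < ?n" and w: "w \<in> carrier_vec ?n" and x: "\<And>j. j < ?n \<Longrightarrow> w $ j = x (vs ! j)" for w i x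
  proof -
    have "(A_alpha \<alpha> vs G *\<^sub>v w) $ i = (\<Sum>j<?n. A_alpha \<alpha> vs G $$ (i, j) * w $ j)"
      using i w by (simp add: scalar_prod_def lessThan_atLeast0)
    also have "\<dots> = (\<Sum>j<?n. (if i = j then \<alpha> * real (out_degree (with_proj G) (vs ! i)) * x (vs ! i) else 0)
        + (1 - \<alpha>) * (if (vs ! i, vs ! j) \<in> parcs G then x (vs ! j) else 0))"
      using i by (intro sum.cong)
        (auto simp: A_alpha_def degree_matrix_def adjacency_matrix_def x algebra_simps)
    also have "\<dots> = \<alpha> * real (out_degree (with_proj G) (vs ! i)) * x (vs ! i) +
        (1 - \<alpha>) * (\<Sum>j<?n. if (vs ! i, vs ! j) \<in> parcs G then x (vs ! j) else 0)"
      using i by (simp add: sum.distrib sum_distrib_left)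
    also have "(\<Sum>j<?n. if (vs ! i, vs ! j) \<in> parcs G then x (vs ! j) else 0) =
        (\<Sum>v\<in>set vs. if (vs ! i, v) \<in> parcs G then x v else 0)"
      by (rule sum.reindex_bij_betw[OF bij_betw_nth[OF assms refl refl]])
    finally show ?thesis .
  qed
  show ?thesis
  proof
    assume "eigenvalue (A_alpha \<alpha> vs G) k"
    then obtain w where w: "w \<in> carrier_vec ?n" "w \<noteq> 0\<^sub>v ?n" "A_alpha \<alpha> vs G *\<^sub>v w = k \<cdot>\<^sub>v w"
      by (auto simp: eigenvalue_def eigenvector_def)
    define x where "x v = w $ (the_inv_into {..<?n} ((!) vs) v)" for v
    have x: "w $ j = x (vs ! j)" if "j < ?n" for j
      using that assms by (simp add: x_def the_inv_into_f_f inj_on_nth)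
    obtain i where "i < ?n" "w $ i \<noteq> 0"
      using w(1,2) by (metis carrier_vecD eq_vecI index_zero_vec)
    then have "\<exists>v\<in>set vs. x v \<noteq> 0" using x by (metis nth_mem)
    moreover have "(A_alpha \<alpha> vs G *\<^sub>v w) $ i = k * x (vs ! i)" if "i < ?n" for i
      using that w x by simp
    ultimately have "?P x"
      using row[OF _ w(1) x] by (auto simp: in_set_conv_nth)
    then show "\<exists>x. ?P x" by (rule exI[of _ x])
  next
    assume "\<exists>x. ?P x"
    then obtain x where x: "?P x" ..
    define w where "w = vec ?n (\<lambda>i. x (vs ! i))"
    have w: "w \<in> carrier_vec ?n" "\<And>j. j < ?n \<Longrightarrow> w $ j = x (vs ! j)"
      by (simp_all add: w_def)
    have "w \<noteq> 0\<^sub>v ?n"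
      using x w(2) by (metis in_set_conv_nth index_zero_vec(1))
    moreover have "A_alpha \<alpha> vs G *\<^sub>v w = k \<cdot>\<^sub>v w"
    proof (rule eq_vecI)
      fix i assume "i < dim_vec (k \<cdot>\<^sub>v w)"
      then have i: "i < ?n" using w(1) by simp
      show "(A_alpha \<alpha> vs G *\<^sub>v w) $ i = (k \<cdot>\<^sub>v w) $ i"
        using row[OF i w] x i w by simp
    qed (use w in simp)
    ultimately show "eigenvalue (A_alpha \<alpha> vs G) k"
      using w(1) by (auto simp: eigenvalue_def eigenvector_def)
  qed
qed

lemma spectrum_A_alpha_enumeration:
  assumes "distinct vs" "distinct ws" "set vs = set ws"
  shows "spectrum (A_alpha \<alpha> vs G) = spectrum (A_alpha \<alpha> ws G)"
  using assms unfolding spectrum_def by (intro Collect_cong) (simp add: eigenvalue_A_alpha_iff)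

lemma pair_graph_star_plus_edge:
  assumes "n \<ge> 3"
  shows "pair_graph (star_plus_edge n)"
  using assms
  by unfold_locales (auto simp: star_plus_edge_def star_def symmetric_def intro!: symI)

end

theory Submission
  imports Defs "HOL-Analysis.Function_Topology"
begin

text \<open>
  Let \<open>D\<close> be the maximum degree of \<open>G\<close> and \<open>t\<close> the largest eigenvalue of \<open>S\<^sub>n + e\<close>, which belongs to
  an explicit positive eigenvector.

  If \<open>D = n - 1\<close>, then since \<open>G\<close> is not bipartite two neighbours of a vertex of degree \<open>D\<close> are
  adjacent, so \<open>G\<close> contains \<open>S\<^sub>n + e\<close> as a spanning subgraph. Every further edge increases the
  quadratic form of \<open>A\<^sub>\<alpha>\<close> at the positive eigenvector, so the largest eigenvalue of \<open>G\<close> exceeds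
  \<open>t\<close> unless \<open>G\<close> is \<open>S\<^sub>n + e\<close>.

  If \<open>D < n - 1\<close>, it is enough that \<open>G\<close> contains a star with \<open>D\<close> edges: this bounds its largest
  eigenvalue \<open>m\<close> from below by \<open>\<alpha> D + (1 - \<alpha>)\<^sup>2 D / (m - \<alpha>)\<close>, and comparing with the equation
  satisfied by \<open>t\<close> gives \<open>t < m + (n - 1 - D)\<close>.
\<close>

section \<open>The largest eigenvalue as a maximum of a quadratic form\<close>

text \<open>Tychonoff. Freezing all coordinates outside \<open>V\<close> at 0 makes every factor
  compact, so vectors indexed by \<open>V\<close> can be taken as functions on the whole
  type.\<close>

lemma compact_functions_into_box:
  "compact {x :: 'a \<Rightarrow> real. \<forall>i. x i \<in> (if i \<in> V then {-1..1} else {0})}"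
proof -
  have "compactin (product_topology (\<lambda>_. euclidean) UNIV)
      (PiE UNIV (\<lambda>i. if i \<in> V then {-1..1::real} else {0}))"
    by (subst compactin_PiE) simp
  moreover have "PiE UNIV (\<lambda>i. if i \<in> V then {-1..1::real} else {0}) =
      {x :: 'a \<Rightarrow> real. \<forall>i. x i \<in> (if i \<in> V then {-1..1} else {0})}"
    by (simp add: PiE_UNIV_domain Pi_def)
  ultimately show ?thesis
    by (simp add: euclidean_product_topology)
qed

text \<open>First-order condition at a maximum: for a small step in the direction of
  \<open>r\<close> the linear term would outweigh the quadratic one.\<close>

lemma linear_term_zero_of_nonpos_quadratic:
  fixes r c :: real
  assumes "\<And>s. 2 * s * r + s\<^sup>2 * c \<le> 0"
  shows "r = 0"
proof (rule ccontr)
  assume r: "r \<noteq> 0"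
  define k where "k = \<bar>c\<bar> + 1"
  have k: "k > 0" "2 * k + c > 0" by (auto simp: k_def)
  have "2 * (r / k) * r + (r / k)\<^sup>2 * c = r\<^sup>2 / k\<^sup>2 * (2 * k + c)"
    using k by (simp add: field_simps power2_eq_square)
  also have "\<dots> > 0" using k r by simp
  finally show False using assms[of "r / k"] by simp
qed

text \<open>Expansion along the coordinate direction \<open>u\<close>. By symmetry the row and the
  column of \<open>u\<close> contribute equally, so the derivative is twice entry \<open>u\<close>
  of \<open>B x\<close>.\<close>

lemma quadratic_form_perturb:
  fixes B :: "'a \<Rightarrow> 'a \<Rightarrow> real"
  assumes V: "finite V" "u \<in> V" and sym: "\<And>u v. B u v = B v u"
  defines "P \<equiv> \<lambda>x. \<Sum>i\<in>V. \<Sum>j\<in>V. B i j * x i * x j"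
  shows "P (\<lambda>i. x i + s * of_bool (i = u)) =
    P x + 2 * s * (\<Sum>j\<in>V. B u j * x j) + s\<^sup>2 * B u u"
proof -
  have delta: "(\<Sum>j\<in>V. of_bool (j = u) * h j) = h u" for h :: "'a \<Rightarrow> real"
  proof -
    have "(\<Sum>j\<in>V. of_bool (j = u) * h j) = (\<Sum>j\<in>V. if j = u then h j else 0)"
      by (intro sum.cong) auto
    then show ?thesis using V by simp
  qed
  have "P (\<lambda>i. x i + s * of_bool (i = u)) =
    (\<Sum>i\<in>V. (\<Sum>j\<in>V. B i j * x i * x j) + (s * (B i u * x i)) +
      of_bool (i = u) * (s * (\<Sum>j\<in>V. B i j * x j) + s\<^sup>2 * B i u))"
    unfolding P_def
  proof (intro sum.cong refl)
    fix i assume "i \<in> V"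
    have "(\<Sum>j\<in>V. B i j * (x i + s * of_bool (i = u)) * (x j + s * of_bool (j = u))) =
      (\<Sum>j\<in>V. B i j * x i * x j + of_bool (i = u) * s * (B i j * x j) +
        of_bool (j = u) * (s * B i j * x i + of_bool (i = u) * s\<^sup>2 * B i j))"
      by (intro sum.cong refl) (auto simp: algebra_simps power2_eq_square)
    also have "\<dots> = (\<Sum>j\<in>V. B i j * x i * x j) + of_bool (i = u) * s * (\<Sum>j\<in>V. B i j * x j)
        + (s * B i u * x i + of_bool (i = u) * s\<^sup>2 * B i u)"
      by (simp only: sum.distrib delta flip: sum_distrib_left)
    finally show "(\<Sum>j\<in>V. B i j * (x i + s * of_bool (i = u)) * (x j + s * of_bool (j = u))) =
      (\<Sum>j\<in>V. B i j * x i * x j) + (s * (B i u * x i)) +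
      of_bool (i = u) * (s * (\<Sum>j\<in>V. B i j * x j) + s\<^sup>2 * B i u)"
      by (simp add: algebra_simps)
  qed
  also have "\<dots> = P x + s * (\<Sum>i\<in>V. B i u * x i) + (s * (\<Sum>j\<in>V. B u j * x j) + s\<^sup>2 * B u u)"
    by (simp only: P_def sum.distrib delta flip: sum_distrib_left)
  also have "(\<Sum>i\<in>V. B i u * x i) = (\<Sum>j\<in>V. B u j * x j)"
    by (simp add: sym)
  finally show ?thesis by simp
qed

text \<open>Maximise the form on the unit sphere, which is compact. At a maximiser the derivative in
  every coordinate direction of the form of \<open>M - m I\<close> vanishes, and this is the
  eigenvalue equation.\<close>

lemma symmetric_form_max_eigenvalue:
  fixes M :: "'a \<Rightarrow> 'a \<Rightarrow> real"
  assumes V: "finite V" "V \<noteq> {}" and sym: "\<And>u v. M u v = M v u"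
  obtains x m where "\<exists>v\<in>V. x v \<noteq> 0"
    and "\<And>u. u \<in> V \<Longrightarrow> (\<Sum>v\<in>V. M u v * x v) = m * x u"
    and "\<And>y. (\<Sum>u\<in>V. \<Sum>v\<in>V. M u v * y u * y v) \<le> m * (\<Sum>u\<in>V. (y u)\<^sup>2)"
proof -
  define Q where "Q x = (\<Sum>u\<in>V. \<Sum>v\<in>V. M u v * x u * x v)" for x
  define N where "N x = (\<Sum>u\<in>V. (x u)\<^sup>2)" for x :: "'a \<Rightarrow> real"
  define K where "K = {x. \<forall>i. x i \<in> (if i \<in> V then {-1..1::real} else {0})} \<inter> {x. N x = 1}"
  have "continuous_on UNIV N"
    unfolding N_def by (intro continuous_intros continuous_on_product_coordinates)
  then have "closed {x. N x = 1}"
    by (intro closed_Collect_eq continuous_on_const)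
  then have "compact K"
    unfolding K_def by (intro compact_Int_closed compact_functions_into_box)
  moreover have "K \<noteq> {}"
  proof -
    obtain v where v: "v \<in> V" using V by blast
    have "(\<lambda>i. of_bool (i = v)) \<in> K"
      using v V(1) by (auto simp: K_def N_def power2_eq_square)
    then show ?thesis by blast
  qed
  moreover have "continuous_on UNIV Q"
    unfolding Q_def by (intro continuous_intros continuous_on_product_coordinates)
  then have "continuous_on K Q"
    by (rule continuous_on_subset) simp
  ultimately obtain x where x: "x \<in> K" and max: "\<And>y. y \<in> K \<Longrightarrow> Q y \<le> Q x"
    using continuous_attains_sup[of K Q] by auto
  define m where "m = Q x"
  have N_x: "N x = 1" using x by (simp add: K_def)
  have N_nonneg: "N y \<ge> 0" for y by (simp add: N_def sum_nonneg)
  have bound: "Q y \<le> m * N y" for y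
  proof (cases "N y = 0")
    case True
    then have "y u = 0" if "u \<in> V" for u
      using that V(1) by (simp add: N_def sum_nonneg_eq_0_iff)
    then show ?thesis using True by (simp add: Q_def)
  next
    case False
    then have pos: "N y > 0" using N_nonneg[of y] by simp
    define r where "r = sqrt (N y)"
    have r: "r > 0" "r\<^sup>2 = N y" using pos by (auto simp: r_def)
    define z where "z i = (if i \<in> V then y i / r else 0)" for i
    have "N z = N y / r\<^sup>2"
      by (simp add: N_def z_def power_divide sum_divide_distrib)
    then have N_z: "N z = 1" using r pos by simp
    have "\<bar>z i\<bar> \<le> 1" if "i \<in> V" for i
    proof -
      have "(z i)\<^sup>2 \<le> N z"
        unfolding N_def using that V(1) by (intro member_le_sum) auto
      then show ?thesis using N_z by (simp add: abs_square_le_1)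
    qed
    moreover have "z i = 0" if "i \<notin> V" for i
      using that by (simp add: z_def)
    ultimately have "z \<in> K"
      using N_z by (auto simp: K_def abs_le_iff minus_le_iff)
    then have "Q z \<le> m" using max by (simp add: m_def)
    moreover have "Q z = Q y / r\<^sup>2"
      unfolding Q_def sum_divide_distrib
      by (intro sum.cong refl) (simp add: z_def power2_eq_square)
    ultimately show ?thesis
      using r pos by (simp add: field_simps)
  qed
  \<comment> \<open>Subtracting \<open>m I\<close> makes the form nonpositive everywhere and zero at
    \<open>x\<close>, so perturbations of \<open>x\<close> need not be kept on the sphere.\<close>
  define B where "B u v = M u v - of_bool (u = v) * m" for u v
  have B_form: "(\<Sum>i\<in>V. \<Sum>j\<in>V. B i j * y i * y j) = Q y - m * N y" for y
  proof -
    have "(\<Sum>j\<in>V. B i j * y i * y j) = (\<Sum>j\<in>V. M i j * y i * y j) - m * (y i)\<^sup>2" if "i \<in> V" for i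
    proof -
      have "(\<Sum>j\<in>V. B i j * y i * y j) = (\<Sum>j\<in>V. M i j * y i * y j - (if i = j then m * y i * y j else 0))"
        by (intro sum.cong refl) (auto simp: B_def algebra_simps)
      then show ?thesis
        using that V(1) by (simp add: sum_subtractf power2_eq_square)
    qed
    then show ?thesis
      by (simp add: Q_def N_def sum_subtractf sum_distrib_left)
  qed
  have "(\<Sum>v\<in>V. M u v * x v) = m * x u" if u: "u \<in> V" for u
  proof -
    have "(\<Sum>j\<in>V. B u j * x j) = 0"
    proof (rule linear_term_zero_of_nonpos_quadratic)
      fix s
      have "B i j = B j i" for i j by (auto simp: B_def sym)
      from quadratic_form_perturb[of V u B x s, OF V(1) u this]
      show "2 * s * (\<Sum>j\<in>V. B u j * x j) + s\<^sup>2 * B u u \<le> 0"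
        using bound[of "\<lambda>i. x i + s * of_bool (i = u)"] N_x
        unfolding B_form m_def by simp
    qed
    moreover have "(\<Sum>j\<in>V. B u j * x j) = (\<Sum>j\<in>V. M u j * x j - (if u = j then m * x j else 0))"
      by (intro sum.cong refl) (auto simp: B_def algebra_simps)
    ultimately show ?thesis
      using u V(1) by (simp add: sum_subtractf)
  qed
  moreover have "\<exists>v\<in>V. x v \<noteq> 0"
  proof (rule ccontr)
    assume "\<not> (\<exists>v\<in>V. x v \<noteq> 0)"
    then have "N x = 0" by (simp add: N_def)
    then show False using N_x by simp
  qed
  ultimately show thesis
    using bound unfolding Q_def N_def by (intro that[of x m]) blast+
qed

section \<open>Eigenvalue equations and the quadratic form of a graph\<close>

definition neighbours :: "'a pair_pre_digraph \<Rightarrow> 'a \<Rightarrow> 'a set" where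
  "neighbours G u = {v. (u, v) \<in> parcs G}"

text \<open>The form of \<open>A_alpha\<close>: the \<alpha>-terms of the arcs leaving
  \<open>u\<close> add up to the degree term, and the two arcs of an edge give its two matrix
  entries. As a sum over arcs it can be compared between graphs by inclusion of their arc
  sets.\<close>

definition A_form :: "real \<Rightarrow> 'a pair_pre_digraph \<Rightarrow> ('a \<Rightarrow> real) \<Rightarrow> real" where
  "A_form \<alpha> G x = (\<Sum>(u, v)\<in>parcs G. \<alpha> * (x u)\<^sup>2 + (1 - \<alpha>) * x u * x v)"

lemma out_degree_eq_card_neighbours: "out_degree (with_proj G) u = card (neighbours G u)"
proof -
  have "out_arcs (with_proj G) u = Pair u ` neighbours G u"
    by (auto simp: out_arcs_def neighbours_def)
  then show ?thesis
    by (simp add: out_degree_def card_image inj_on_def)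
qed

context pair_graph
begin

lemma neighbours_subset: "neighbours G u \<subseteq> pverts G"
  by (auto simp: neighbours_def dest: in_arcsD2)

lemma finite_neighbours [simp]: "finite (neighbours G u)"
  using neighbours_subset pair_finite_verts by (rule finite_subset)

lemma sum_arcs: "(\<Sum>(u, v)\<in>parcs G. f u v) = (\<Sum>u\<in>pverts G. \<Sum>v\<in>neighbours G u. f u v)"
proof -
  have "parcs G = Sigma (pverts G) (neighbours G)"
    by (auto simp: neighbours_def dest: in_arcsD1)
  then show ?thesis
    by (simp add: sum.Sigma pair_finite_verts)
qed

lemma sum_arcs_swap: "(\<Sum>(u, v)\<in>parcs G. f v u) = (\<Sum>(u, v)\<in>parcs G. f u v)"
  by (rule sum.reindex_bij_witness[where i = prod.swap and j = prod.swap])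
     (auto dest: arcs_symmetric)

text \<open>The degree term is spread over the neighbours, one \<alpha> for each, so that a row of
  the matrix equation becomes a single sum. All later eigenvalue equations have this shape.\<close>

lemma sum_neighbours_conv:
  "(\<Sum>v\<in>neighbours G u. \<alpha> * x u + (1 - \<alpha>) * x v) =
    \<alpha> * real (out_degree (with_proj G) u) * x u +
    (1 - \<alpha>) * (\<Sum>v\<in>pverts G. if (u, v) \<in> parcs G then x v else 0)"
proof -
  have "(\<Sum>v\<in>pverts G. if (u, v) \<in> parcs G then x v else 0) = (\<Sum>v\<in>neighbours G u. x v)"
    using neighbours_subset[of u]
    by (simp add: sum.If_cases pair_finite_verts neighbours_def Int_absorb1)
  then show ?thesis
    by (simp add: sum.distrib sum_distrib_left out_degree_eq_card_neighbours)
qed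

lemma eigenvalue_A_alpha_iff_neighbours:
  "k \<in> spectrum (A_alpha \<alpha> (vertex_list G) G) \<longleftrightarrow>
    (\<exists>x. (\<exists>v\<in>pverts G. x v \<noteq> 0) \<and>
      (\<forall>u\<in>pverts G. (\<Sum>v\<in>neighbours G u. \<alpha> * x u + (1 - \<alpha>) * x v) = k * x u))"
  unfolding spectrum_def sum_neighbours_conv
  by (simp add: eigenvalue_A_alpha_iff vertex_list[OF pair_graph])

lemma A_form_conv:
  "A_form \<alpha> G x = (\<Sum>u\<in>pverts G. x u * (\<Sum>v\<in>neighbours G u. \<alpha> * x u + (1 - \<alpha>) * x v))"
  unfolding A_form_def sum_arcs
  by (simp add: sum_distrib_left algebra_simps power2_eq_square)

lemma A_form_eigenvector:
  assumes "\<And>u. u \<in> pverts G \<Longrightarrow> (\<Sum>v\<in>neighbours G u. \<alpha> * x u + (1 - \<alpha>) * x v) = k * x u"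
  shows "A_form \<alpha> G x = k * (\<Sum>u\<in>pverts G. (x u)\<^sup>2)"
  unfolding A_form_conv using assms by (simp add: sum_distrib_left power2_eq_square mult_ac)

lemma sum_squares_pos:
  fixes x :: "'a \<Rightarrow> real"
  assumes "\<exists>v\<in>pverts G. x v \<noteq> 0"
  shows "(\<Sum>u\<in>pverts G. (x u)\<^sup>2) > 0"
  using assms pair_finite_verts by (auto intro: sum_pos2)

text \<open>The maximum \<open>m\<close> of the form on the unit sphere is an eigenvalue, and every
  other eigenvalue is the Rayleigh quotient of its eigenvector, hence at most \<open>m\<close>. So
  the \<open>Max\<close> in \<open>rho\<close> is \<open>m\<close>.\<close>

lemma
  assumes "pverts G \<noteq> {}"
  shows A_form_le_rho: "A_form \<alpha> G y \<le> rho \<alpha> G * (\<Sum>u\<in>pverts G. (y u)\<^sup>2)"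
    and rho_in_spectrum: "rho \<alpha> G \<in> spectrum (A_alpha \<alpha> (vertex_list G) G)"
proof -
  let ?S = "spectrum (A_alpha \<alpha> (vertex_list G) G)"
  let ?V = "pverts G"
  define M where "M u v = (if u = v then \<alpha> * real (out_degree (with_proj G) u) else 0) +
    (if (u, v) \<in> parcs G then 1 - \<alpha> else 0)" for u v
  have M_sym: "M u v = M v u" for u v
    by (auto simp: M_def dest: arcs_symmetric)
  have M_row: "(\<Sum>v\<in>?V. M u v * x v) = (\<Sum>v\<in>neighbours G u. \<alpha> * x u + (1 - \<alpha>) * x v)"
    if "u \<in> ?V" for u x
  proof -
    have "(\<Sum>v\<in>?V. M u v * x v) =
      (\<Sum>v\<in>?V. (if u = v then \<alpha> * real (out_degree (with_proj G) u) * x v else 0) +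
        (1 - \<alpha>) * (if (u, v) \<in> parcs G then x v else 0))"
      by (intro sum.cong refl) (auto simp: M_def algebra_simps)
    then show ?thesis
      unfolding sum_neighbours_conv
      using that by (simp add: sum.distrib sum_distrib_left pair_finite_verts)
  qed
  have M_form: "(\<Sum>u\<in>?V. \<Sum>v\<in>?V. M u v * y u * y v) = A_form \<alpha> G y" for y
  proof -
    have "(\<Sum>u\<in>?V. \<Sum>v\<in>?V. M u v * y u * y v) = (\<Sum>u\<in>?V. y u * (\<Sum>v\<in>?V. M u v * y v))"
      by (simp add: sum_distrib_left mult_ac)
    then show ?thesis by (simp add: M_row A_form_conv)
  qed
  obtain x m where x: "\<exists>v\<in>?V. x v \<noteq> 0" "\<And>u. u \<in> ?V \<Longrightarrow> (\<Sum>v\<in>?V. M u v * x v) = m * x u"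
    and m: "\<And>y. (\<Sum>u\<in>?V. \<Sum>v\<in>?V. M u v * y u * y v) \<le> m * (\<Sum>u\<in>?V. (y u)\<^sup>2)"
    by (rule symmetric_form_max_eigenvalue[OF pair_finite_verts assms, of M, OF M_sym]) blast
  have fin: "finite ?S"
    by (rule card_finite_spectrum[of _ "length (vertex_list G)"])
       (simp add: A_alpha_def degree_matrix_def adjacency_matrix_def)
  have m_in: "m \<in> ?S"
    unfolding eigenvalue_A_alpha_iff_neighbours using x M_row by (intro exI[of _ x]) auto
  have "k \<le> m" if k: "k \<in> ?S" for k
  proof -
    obtain z where z: "\<exists>v\<in>?V. z v \<noteq> 0"
      "\<And>u. u \<in> ?V \<Longrightarrow> (\<Sum>v\<in>neighbours G u. \<alpha> * z u + (1 - \<alpha>) * z v) = k * z u"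
      using k unfolding eigenvalue_A_alpha_iff_neighbours by blast
    then show ?thesis
      using A_form_eigenvector[of \<alpha> z k] m[of z] sum_squares_pos[of z]
      by (simp add: M_form)
  qed
  then have "rho \<alpha> G = m"
    unfolding rho_def using fin m_in by (intro Max_eqI) auto
  then show "A_form \<alpha> G y \<le> rho \<alpha> G * (\<Sum>u\<in>?V. (y u)\<^sup>2)" "rho \<alpha> G \<in> ?S"
    using m m_in by (simp_all add: M_form)
qed

text \<open>By AM-GM, \<open>2 x\<^sub>u x\<^sub>v \<le> x\<^sub>u\<^sup>2 y\<^sub>v / y\<^sub>u + x\<^sub>v\<^sup>2 y\<^sub>u / y\<^sub>v\<close>; summing this over all arcs
  bounds the quadratic form at \<open>x\<close>.\<close>

lemma rho_le_of_positive_supersolution: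
  assumes "pverts G \<noteq> {}" and \<alpha>: "\<alpha> \<le> 1"
    and y: "\<And>u. u \<in> pverts G \<Longrightarrow> y u > 0"
    and super: "\<And>u. u \<in> pverts G \<Longrightarrow> (\<Sum>v\<in>neighbours G u. \<alpha> * y u + (1 - \<alpha>) * y v) \<le> t * y u"
  shows "rho \<alpha> G \<le> t"
proof -
  obtain x where x: "\<exists>v\<in>pverts G. x v \<noteq> 0"
    "\<And>u. u \<in> pverts G \<Longrightarrow> (\<Sum>v\<in>neighbours G u. \<alpha> * x u + (1 - \<alpha>) * x v) = rho \<alpha> G * x u"
    using rho_in_spectrum[OF assms(1), of \<alpha>] unfolding eigenvalue_A_alpha_iff_neighbours by blast
  define g where "g u v = (1 - \<alpha>) / 2 * ((x u)\<^sup>2 * (y v / y u))" for u v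
  have "A_form \<alpha> G x \<le> (\<Sum>(u, v)\<in>parcs G. \<alpha> * (x u)\<^sup>2 + (g u v + g v u))"
    unfolding A_form_def
  proof (rule sum_mono, clarify)
    fix u v assume uv: "(u, v) \<in> parcs G"
    then have pos: "y u > 0" "y v > 0" using y in_arcsD1 in_arcsD2 by blast+
    have "0 \<le> (x u * y v - x v * y u)\<^sup>2 / (y u * y v)"
      using pos by simp
    also have "\<dots> = (x u)\<^sup>2 * (y v / y u) + (x v)\<^sup>2 * (y u / y v) - 2 * x u * x v"
      using pos by (simp add: field_simps power2_eq_square)
    finally have "x u * x v \<le> ((x u)\<^sup>2 * (y v / y u) + (x v)\<^sup>2 * (y u / y v)) / 2"
      by simp
    from mult_left_mono[OF this, of "1 - \<alpha>"] \<alpha>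
    show "\<alpha> * (x u)\<^sup>2 + (1 - \<alpha>) * x u * x v \<le> \<alpha> * (x u)\<^sup>2 + (g u v + g v u)"
      by (simp add: g_def algebra_simps add_divide_distrib diff_divide_distrib)
  qed
  also have "\<dots> = (\<Sum>(u, v)\<in>parcs G. \<alpha> * (x u)\<^sup>2) + (\<Sum>(u, v)\<in>parcs G. g u v) + (\<Sum>(u, v)\<in>parcs G. g v u)"
    by (simp add: sum.distrib case_prod_unfold)
  \<comment> \<open>Reversing all arcs turns the sum of \<open>g v u\<close> into that of
    \<open>g u v\<close>; everything is then collected at the tail \<open>u\<close>, where
    \<open>super\<close> applies.\<close>
  also have "\<dots> = (\<Sum>(u, v)\<in>parcs G. \<alpha> * (x u)\<^sup>2 + (g u v + g u v))"
    unfolding sum_arcs_swap[of g] by (simp only: sum.distrib case_prod_unfold add.assoc)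
  also have "\<dots> = (\<Sum>u\<in>pverts G. (x u)\<^sup>2 / y u * (\<Sum>v\<in>neighbours G u. \<alpha> * y u + (1 - \<alpha>) * y v))"
    unfolding sum_arcs sum_distrib_left
  proof (intro sum.cong refl)
    fix u v assume "u \<in> pverts G"
    then have "y u > 0" by (rule y)
    then show "\<alpha> * (x u)\<^sup>2 + (g u v + g u v) = (x u)\<^sup>2 / y u * (\<alpha> * y u + (1 - \<alpha>) * y v)"
      by (simp add: g_def field_simps)
  qed
  also have "\<dots> \<le> (\<Sum>u\<in>pverts G. (x u)\<^sup>2 / y u * (t * y u))"
    using super y by (intro sum_mono mult_left_mono) (auto simp: less_imp_le)
  also have "\<dots> = t * (\<Sum>u\<in>pverts G. (x u)\<^sup>2)"
    unfolding sum_distrib_left using y by (intro sum.cong refl) (fastforce simp: field_simps)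
  finally show ?thesis
    using A_form_eigenvector[OF x(2)] sum_squares_pos[OF x(1)] by simp
qed

text \<open>The upper bound holds because \<open>y\<close> is its own supersolution, the lower bound
  because \<open>t\<close> is the Rayleigh quotient at \<open>y\<close>.\<close>

lemma rho_eq_of_positive_eigenvector:
  assumes "pverts G \<noteq> {}" and "\<alpha> \<le> 1"
    and y: "\<And>u. u \<in> pverts G \<Longrightarrow> y u > 0"
    and eig: "\<And>u. u \<in> pverts G \<Longrightarrow> (\<Sum>v\<in>neighbours G u. \<alpha> * y u + (1 - \<alpha>) * y v) = t * y u"
  shows "rho \<alpha> G = t"
proof (rule antisym)
  show "rho \<alpha> G \<le> t"
    using assms by (intro rho_le_of_positive_supersolution[of \<alpha> y]) auto
  have "\<exists>v\<in>pverts G. y v \<noteq> 0" using assms(1) y by fastforce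
  then show "t \<le> rho \<alpha> G"
    using A_form_le_rho[OF assms(1), of \<alpha> y] A_form_eigenvector[OF eig] sum_squares_pos[of y]
    by simp
qed

text \<open>Rayleigh quotient of the vector that is 1 at \<open>c\<close>, \<open>s\<close> on its neighbours and 0 elsewhere.\<close>

lemma rho_star_bound:
  assumes c: "c \<in> pverts G" and \<alpha>: "0 \<le> \<alpha>" "\<alpha> \<le> 1" and s: "s \<ge> 0"
  defines "D \<equiv> real (card (neighbours G c))"
  shows "D * (\<alpha> + \<alpha> * s\<^sup>2 + 2 * (1 - \<alpha>) * s) \<le> rho \<alpha> G * (1 + D * s\<^sup>2)"
proof -
  let ?N = "neighbours G c"
  define x where "x u = (if u = c then 1 else if u \<in> ?N then s else 0)" for u
  have cN: "c \<notin> ?N" using no_loops' by (auto simp: neighbours_def)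
  have "(\<Sum>u\<in>pverts G. (x u)\<^sup>2) = (\<Sum>u\<in>insert c ?N. (x u)\<^sup>2)"
    using c neighbours_subset by (intro sum.mono_neutral_right) (auto simp: x_def pair_finite_verts)
  also have "\<dots> = 1 + (\<Sum>u\<in>?N. s\<^sup>2)"
    using cN by (subst sum.insert) (auto simp: x_def simp del: sum_constant intro!: sum.cong)
  finally have norm: "(\<Sum>u\<in>pverts G. (x u)\<^sup>2) = 1 + D * s\<^sup>2" by (simp add: D_def)
  let ?f = "\<lambda>(u, v). \<alpha> * (x u)\<^sup>2 + (1 - \<alpha>) * x u * x v"
  have "(\<Sum>e\<in>Pair c ` ?N. ?f e) + (\<Sum>e\<in>(\<lambda>v. (v, c)) ` ?N. ?f e) = (\<Sum>e\<in>Pair c ` ?N \<union> (\<lambda>v. (v, c)) ` ?N. ?f e)"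
    using cN by (intro sum.union_disjoint[symmetric]) auto
  \<comment> \<open>The remaining arcs contribute nonnegative terms, since \<open>x\<close>,
    \<alpha> and 1 - \<alpha> are nonnegative.\<close>
  also have "\<dots> \<le> A_form \<alpha> G x"
    unfolding A_form_def
    by (intro sum_mono2 pair_finite_arcs)
       (use \<alpha> s in \<open>auto simp: x_def neighbours_def arcs_symmetric\<close>)
  also have "(\<Sum>e\<in>Pair c ` ?N. ?f e) = (\<Sum>v\<in>?N. \<alpha> + (1 - \<alpha>) * s)"
    using cN by (subst sum.reindex) (auto simp: inj_on_def x_def simp del: sum_constant intro!: sum.cong)
  also have "(\<Sum>e\<in>(\<lambda>v. (v, c)) ` ?N. ?f e) = (\<Sum>v\<in>?N. \<alpha> * s\<^sup>2 + (1 - \<alpha>) * s)"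
  proof -
    have "(\<Sum>e\<in>(\<lambda>v. (v, c)) ` ?N. ?f e) = (\<Sum>v\<in>?N. ?f (v, c))"
      by (subst sum.reindex) (auto simp: inj_on_def)
    also have "\<dots> = (\<Sum>v\<in>?N. \<alpha> * s\<^sup>2 + (1 - \<alpha>) * s)"
      using cN by (intro sum.cong refl) (auto simp: x_def)
    finally show ?thesis .
  qed
  finally have "D * (\<alpha> + (1 - \<alpha>) * s) + D * (\<alpha> * s\<^sup>2 + (1 - \<alpha>) * s) \<le> A_form \<alpha> G x"
    by (simp add: D_def)
  also have "\<dots> \<le> rho \<alpha> G * (1 + D * s\<^sup>2)"
    using A_form_le_rho[of \<alpha> x] c norm by auto
  finally show ?thesis by (simp add: algebra_simps)
qed

end

section \<open>The largest eigenvalue of a star with one additional edge\<close>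

text \<open>The fixed points of this function are the eigenvalues of \<open>S\<^sub>n + e\<close>, \<open>d = n - 1\<close>, whose
  eigenvectors are 1 at the centre and constant on the two other vertices of the triangle and on
  the leaves: the eigenvalue equation determines these constants as \<open>(1 - \<alpha>) / (t - 1 - \<alpha>)\<close> and
  \<open>(1 - \<alpha>) / (t - \<alpha>)\<close>.\<close>

definition centre_map :: "real \<Rightarrow> real \<Rightarrow> real \<Rightarrow> real" where
  "centre_map \<alpha> d t = \<alpha> * d + (1 - \<alpha>)\<^sup>2 * (2 / (t - 1 - \<alpha>) + (d - 2) / (t - \<alpha>))"

text \<open>Supplies the right end point for the intermediate value theorem, and later the bound
  \<open>t < d\<close>.\<close>

lemma centre_map_less:
  assumes \<alpha>: "0 \<le> \<alpha>" "\<alpha> < 1" and d: "d \<ge> 3"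
  shows "centre_map \<alpha> d d < d"
proof -
  have "2 / (d - 1 - \<alpha>) \<le> 2" "(d - 2) / (d - \<alpha>) < 1"
    using \<alpha> d by (simp_all add: divide_simps)
  then have "2 / (d - 1 - \<alpha>) + (d - 2) / (d - \<alpha>) < d" using d by simp
  moreover have "(1 - \<alpha>)\<^sup>2 \<le> 1 - \<alpha>"
    using \<alpha> by (simp add: power2_eq_square mult_left_le)
  moreover have "(1 - \<alpha>)\<^sup>2 > 0" using \<alpha> by simp
  ultimately have "(1 - \<alpha>)\<^sup>2 * (2 / (d - 1 - \<alpha>) + (d - 2) / (d - \<alpha>)) < (1 - \<alpha>)\<^sup>2 * d"
    by simp
  also have "\<dots> \<le> (1 - \<alpha>) * d"
    using \<open>(1 - \<alpha>)\<^sup>2 \<le> 1 - \<alpha>\<close> d by (intro mult_right_mono) auto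
  finally show ?thesis by (simp add: centre_map_def algebra_simps)
qed

lemma centre_map_fixed_point:
  assumes \<alpha>: "0 \<le> \<alpha>" "\<alpha> < 1" and d: "d \<ge> 3"
  obtains t where "t \<ge> 2" "centre_map \<alpha> d t = t"
proof -
  have "\<exists>t\<ge>2. t \<le> d \<and> centre_map \<alpha> d t - t = 0"
  proof (rule IVT2')
    show "centre_map \<alpha> d d - d \<le> 0"
      using centre_map_less[OF assms] by simp
    \<comment> \<open>At 2 the triangle term alone gives 2 (1 - \<alpha>), and \<alpha> d \<ge> 2
      \<alpha> supplies the rest of the required value 2.\<close>
    have "(1 - \<alpha>)\<^sup>2 * (2 / (1 - \<alpha>)) = 2 * (1 - \<alpha>)"
      using \<alpha> by (simp add: power2_eq_square)
    moreover have "(1 - \<alpha>)\<^sup>2 * ((d - 2) / (2 - \<alpha>)) \<ge> 0" using \<alpha> d by simp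
    moreover have "\<alpha> * (d - 2) \<ge> 0" using \<alpha> d by simp
    ultimately show "0 \<le> centre_map \<alpha> d 2 - 2"
      by (simp add: centre_map_def algebra_simps)
    show "2 \<le> d" using d by simp
    show "continuous_on {2..d} (\<lambda>t. centre_map \<alpha> d t - t)"
      unfolding centre_map_def using \<alpha> by (intro continuous_intros) auto
  qed
  then show thesis using that by auto
qed

text \<open>To the right of the pole 1 + \<alpha> the map is decreasing, so a point that lies above
  its own image lies beyond the fixed point.\<close>

lemma centre_map_fixed_point_less:
  assumes "0 \<le> \<alpha>" "\<alpha> < 1" "d \<ge> 2"
    and t: "centre_map \<alpha> d t = t" and s: "1 + \<alpha> < s" "centre_map \<alpha> d s < s"
  shows "t < s"
proof (rule ccontr)
  assume "\<not> t < s"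
  then have "s \<le> t" by simp
  have "centre_map \<alpha> d t \<le> centre_map \<alpha> d s"
    unfolding centre_map_def using assms \<open>s \<le> t\<close>
    by (intro add_left_mono mult_left_mono add_mono divide_left_mono) auto
  then show False using t s \<open>s \<le> t\<close> by simp
qed

text \<open>Here \<open>D\<close> stands for the maximum degree, \<open>k\<close> for
  \<open>n - 1 - D\<close> and \<open>m\<close> for the largest eigenvalue. The shift by k \<ge> 1
  absorbs the 1 in the triangle denominator, the \<open>k\<close> additional leaves add less than 1
  to the bracket, and (1 - \<alpha>)^2 \<le> (1 - \<alpha>) k turns this into the missing part of
  \<open>k\<close>.\<close>

lemma centre_map_less_shifted:
  assumes \<alpha>: "0 \<le> \<alpha>" "\<alpha> < 1" and D: "D \<ge> 2" and k: "k \<ge> 1" and m: "m \<ge> 1"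
    and star: "\<alpha> * D + (1 - \<alpha>)\<^sup>2 * (D / (m - \<alpha>)) \<le> m"
  shows "centre_map \<alpha> (D + k) (m + k) < m + k"
proof -
  have "2 / (m + k - 1 - \<alpha>) \<le> 2 / (m - \<alpha>)"
    using \<alpha> k m by (intro divide_left_mono) auto
  moreover have "(D - 2) / (m + k - \<alpha>) \<le> (D - 2) / (m - \<alpha>)"
    using \<alpha> k m D by (intro divide_left_mono) auto
  moreover have "k / (m + k - \<alpha>) < 1"
    using \<alpha> k m by simp
  moreover have "2 / (m - \<alpha>) + (D - 2) / (m - \<alpha>) = D / (m - \<alpha>)"
    by (simp flip: add_divide_distrib)
  moreover have "(D - 2) / (m + k - \<alpha>) + k / (m + k - \<alpha>) = (D + k - 2) / (m + k - \<alpha>)"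
    by (simp flip: add_divide_distrib)
  ultimately have "2 / (m + k - 1 - \<alpha>) + (D + k - 2) / (m + k - \<alpha>) < D / (m - \<alpha>) + 1"
    by linarith
  then have "(1 - \<alpha>)\<^sup>2 * (2 / (m + k - 1 - \<alpha>) + (D + k - 2) / (m + k - \<alpha>))
      < (1 - \<alpha>)\<^sup>2 * (D / (m - \<alpha>) + 1)"
    using \<alpha> by simp
  also have "\<dots> = (1 - \<alpha>)\<^sup>2 * (D / (m - \<alpha>)) + (1 - \<alpha>)\<^sup>2"
    by (simp add: algebra_simps)
  also have "\<dots> \<le> (1 - \<alpha>)\<^sup>2 * (D / (m - \<alpha>)) + (1 - \<alpha>) * k"
    using \<alpha> k unfolding power2_eq_square by (intro add_left_mono mult_left_mono) auto
  finally have "(1 - \<alpha>)\<^sup>2 * (2 / (m + k - 1 - \<alpha>) + (D + k - 2) / (m + k - \<alpha>))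
      < (1 - \<alpha>)\<^sup>2 * (D / (m - \<alpha>)) + (1 - \<alpha>) * k" .
  moreover have "\<alpha> * (D + k) + (1 - \<alpha>) * k = \<alpha> * D + k"
    by (simp add: algebra_simps)
  ultimately show ?thesis
    unfolding centre_map_def using star by linarith
qed

text \<open>A copy with prescribed centre and triangle, on any vertex type, so that it can be a
  subgraph of \<open>G\<close> on the very vertices of \<open>G\<close>.\<close>

definition star_plus_edge_at :: "'a set \<Rightarrow> 'a \<Rightarrow> 'a \<Rightarrow> 'a \<Rightarrow> 'a pair_pre_digraph" where
  "star_plus_edge_at V c a b =
     \<lparr>pverts = V, parcs = {c} \<times> (V - {c}) \<union> (V - {c}) \<times> {c} \<union> {(a, b), (b, a)}\<rparr>"

lemma star_plus_edge_conv: "star_plus_edge n = star_plus_edge_at {0..<n} 0 1 2"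
  by (auto simp: star_plus_edge_def star_def star_plus_edge_at_def)

locale star_with_triangle =
  fixes V :: "'a set" and c a b :: 'a
  assumes finite: "finite V" and in_V: "c \<in> V" "a \<in> V" "b \<in> V"
    and distinct: "c \<noteq> a" "c \<noteq> b" "a \<noteq> b"
begin

abbreviation "H \<equiv> star_plus_edge_at V c a b"

sublocale H: pair_graph H
  using finite in_V distinct
  by unfold_locales (auto simp: star_plus_edge_at_def symmetric_def intro!: symI)

lemma pverts_H [simp]: "pverts H = V"
  by (simp add: star_plus_edge_at_def)

lemma card_V: "card V \<ge> 3"
  using card_mono[OF finite, of "{c, a, b}"] in_V distinct by simp

lemma neighbours_H:
  "neighbours H c = V - {c}" "neighbours H a = {c, b}" "neighbours H b = {c, a}"
  "u \<in> V \<Longrightarrow> u \<noteq> c \<Longrightarrow> u \<noteq> a \<Longrightarrow> u \<noteq> b \<Longrightarrow> neighbours H u = {c}"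
  using in_V distinct by (auto simp: neighbours_def star_plus_edge_at_def)

lemma max_degree_H: "max_degree H = card V - 1"
  unfolding max_degree_def out_degree_eq_card_neighbours
proof (rule Max_eqI)
  fix k assume "k \<in> (\<lambda>u. card (neighbours H u)) ` pverts H"
  then obtain u where u: "u \<in> V" "k = card (neighbours H u)" by auto
  have "neighbours H u \<subseteq> V - {u}"
    using H.neighbours_subset H.no_loops' by (fastforce simp: neighbours_def)
  then have "k \<le> card (V - {u})"
    unfolding u(2) using finite by (intro card_mono) auto
  then show "k \<le> card V - 1" using u finite by simp
next
  have "card V - 1 = card (neighbours H c)"
    using finite in_V by (simp add: neighbours_H)
  then show "card V - 1 \<in> (\<lambda>u. card (neighbours H u)) ` pverts H"
    using in_V by auto
qed (use finite in simp)

text \<open>The equations at \<open>a\<close>, \<open>b\<close> and the leaves hold by the choice of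
  \<open>p\<close> and \<open>q\<close>; the equation at \<open>c\<close> is the fixed point
  equation. Both values are positive because t \<ge> 2 > 1 + \<alpha>.\<close>

lemma positive_eigenvector:
  assumes \<alpha>: "0 \<le> \<alpha>" "\<alpha> < 1" and t: "t \<ge> 2" "centre_map \<alpha> (real (card V - 1)) t = t"
  obtains y where "\<And>u. y u > 0"
    and "\<And>u. u \<in> V \<Longrightarrow> (\<Sum>v\<in>neighbours H u. \<alpha> * y u + (1 - \<alpha>) * y v) = t * y u"
proof
  define p where "p = (1 - \<alpha>) / (t - 1 - \<alpha>)"
  define q where "q = (1 - \<alpha>) / (t - \<alpha>)"
  define y where "y u = (if u = c then 1 else if u = a \<or> u = b then p else q)" for u
  have p: "p * (t - 1 - \<alpha>) = 1 - \<alpha>" and q: "q * (t - \<alpha>) = 1 - \<alpha>"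
    using \<alpha> t by (simp_all add: p_def q_def)
  show "y u > 0" for u
    using \<alpha> t by (simp add: y_def p_def q_def)
  fix u assume u: "u \<in> V"
  consider "u = c" | "u = a" | "u = b" | "u \<noteq> c" "u \<noteq> a" "u \<noteq> b" by blast
  then show "(\<Sum>v\<in>neighbours H u. \<alpha> * y u + (1 - \<alpha>) * y v) = t * y u"
  proof cases
    case 1
    have "V - {c} = insert a (insert b (V - {c, a, b}))" using in_V distinct by auto
    then have "(\<Sum>v\<in>V - {c}. y v) = y a + (y b + (\<Sum>v\<in>V - {c, a, b}. y v))"
      using finite distinct by simp
    also have "(\<Sum>v\<in>V - {c, a, b}. y v) = (\<Sum>v\<in>V - {c, a, b}. q)"
      by (intro sum.cong) (auto simp: y_def)
    also have "\<dots> = (real (card V - 1) - 2) * q"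
      using card_V finite in_V distinct by (simp add: card_Diff_subset)
    finally have "(\<Sum>v\<in>V - {c}. y v) = 2 * p + (real (card V - 1) - 2) * q"
      using distinct by (simp add: y_def)
    then have "(\<Sum>v\<in>V - {c}. \<alpha> * y c + (1 - \<alpha>) * y v) =
      \<alpha> * real (card V - 1) + (1 - \<alpha>) * (2 * p + (real (card V - 1) - 2) * q)"
      using finite in_V by (simp add: sum.distrib y_def flip: sum_distrib_left)
    also have "\<dots> = centre_map \<alpha> (real (card V - 1)) t"
    proof -
      have "(1 - \<alpha>)\<^sup>2 * (2 / (t - 1 - \<alpha>)) = (1 - \<alpha>) * (2 * p)"
        "(1 - \<alpha>)\<^sup>2 * ((real (card V - 1) - 2) / (t - \<alpha>)) = (1 - \<alpha>) * ((real (card V - 1) - 2) * q)"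
        by (simp_all add: p_def q_def power2_eq_square)
      then show ?thesis by (simp only: centre_map_def distrib_left)
    qed
    finally show ?thesis using t 1 by (simp add: neighbours_H y_def)
  next
    case 2
    then show ?thesis using p distinct by (auto simp: neighbours_H y_def algebra_simps)
  next
    case 3
    then show ?thesis using p distinct by (auto simp: neighbours_H y_def algebra_simps)
  next
    case 4
    then show ?thesis using q u by (simp add: neighbours_H y_def algebra_simps)
  qed
qed

lemma rho_H:
  assumes "0 \<le> \<alpha>" "\<alpha> < 1" "t \<ge> 2" "centre_map \<alpha> (real (card V - 1)) t = t"
  shows "rho \<alpha> H = t"
proof -
  obtain y where "\<And>u. y u > 0"
    "\<And>u. u \<in> V \<Longrightarrow> (\<Sum>v\<in>neighbours H u. \<alpha> * y u + (1 - \<alpha>) * y v) = t * y u"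
    by (rule positive_eigenvector[OF assms]) blast
  then show ?thesis
    using assms in_V by (intro H.rho_eq_of_positive_eigenvector[of \<alpha> y]) auto
qed

lemma gamma_H:
  assumes "0 \<le> \<alpha>" "\<alpha> < 1" "t \<ge> 2" "centre_map \<alpha> (real (card V - 1)) t = t"
  shows "gamma \<alpha> H = real (card V - 1) - t"
  by (simp add: gamma_def max_degree_H rho_H[OF assms])

text \<open>At the positive eigenvector of \<open>H\<close> every arc has a positive term, so an
  additional arc raises the Rayleigh quotient strictly above \<open>t\<close>.\<close>

lemma rho_less_of_proper_supergraph:
  assumes \<alpha>: "0 \<le> \<alpha>" "\<alpha> < 1" and t: "t \<ge> 2" "centre_map \<alpha> (real (card V - 1)) t = t"
    and G: "pair_graph G" "pverts G = V" "parcs H \<subset> parcs G"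
  shows "t < rho \<alpha> G"
proof -
  interpret G: pair_graph G by fact
  obtain y where y: "\<And>u. y u > 0"
    and eig: "\<And>u. u \<in> V \<Longrightarrow> (\<Sum>v\<in>neighbours H u. \<alpha> * y u + (1 - \<alpha>) * y v) = t * y u"
    by (rule positive_eigenvector[OF \<alpha> t]) blast
  have pos: "\<alpha> * (y u)\<^sup>2 + (1 - \<alpha>) * y u * y v > 0" for u v
    using \<alpha> y by (intro add_nonneg_pos mult_pos_pos) auto
  have "t * (\<Sum>u\<in>V. (y u)\<^sup>2) = A_form \<alpha> H y"
    using H.A_form_eigenvector[of \<alpha> y t] eig by simp
  also have "\<dots> < A_form \<alpha> G y"
  proof -
    obtain e where e: "e \<in> parcs G - parcs H" using G(3) by blast
    show ?thesis
      unfolding A_form_def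
      by (rule sum_strict_mono2[OF G.pair_finite_arcs _ e])
         (use G(3) pos in \<open>auto simp: less_imp_le split: prod.split\<close>)
  qed
  also have "\<dots> \<le> rho \<alpha> G * (\<Sum>u\<in>V. (y u)\<^sup>2)"
    using G.A_form_le_rho[of \<alpha> y] in_V G(2) by auto
  finally show ?thesis
    by (simp add: mult_less_cancel_right sum_nonneg leD)
qed

end

section \<open>Isomorphism with a star with one additional edge\<close>

text \<open>An arc of a pair digraph is the pair of its ends, so the vertex map determines the arc
  map.\<close>

lemma digraph_iso_with_proj_iff:
  assumes "pair_wf_digraph G"
  shows "digraph_iso (with_proj G) (with_proj H) \<longleftrightarrow>
    (\<exists>f. inj_on f (pverts G) \<and> pverts H = f ` pverts G \<and> parcs H = map_prod f f ` parcs G)"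
proof
  interpret pair_wf_digraph G by fact
  assume "digraph_iso (with_proj G) (with_proj H)"
  then obtain h where h: "pre_digraph.digraph_isomorphism (with_proj G) h"
    and H: "with_proj H = app_iso h (with_proj G)"
    unfolding digraph_iso_def by blast
  \<comment> \<open>The image is again a pair digraph, so its tail and head functions can only be
    the projections.\<close>
  have tail: "fst = iso_tail h" and head: "snd = iso_head h"
    using arg_cong[OF H, of tail] arg_cong[OF H, of head] by simp_all
  have "iso_arcs h e = map_prod (iso_verts h) (iso_verts h) e" if "e \<in> parcs G" for e
    using that h unfolding pre_digraph.digraph_isomorphism_def
    by (auto simp: prod_eq_iff simp flip: tail head)
  then have "parcs H = map_prod (iso_verts h) (iso_verts h) ` parcs G"
    using arg_cong[OF H, of arcs] by simp
  moreover have "pverts H = iso_verts h ` pverts G"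
    using arg_cong[OF H, of verts] by simp
  moreover have "inj_on (iso_verts h) (pverts G)"
    using h by (simp add: pre_digraph.digraph_isomorphism_def)
  ultimately show "\<exists>f. inj_on f (pverts G) \<and> pverts H = f ` pverts G \<and> parcs H = map_prod f f ` parcs G"
    by blast
next
  interpret pair_wf_digraph G by fact
  assume "\<exists>f. inj_on f (pverts G) \<and> pverts H = f ` pverts G \<and> parcs H = map_prod f f ` parcs G"
  then obtain f where f: "inj_on f (pverts G)" "pverts H = f ` pverts G" "parcs H = map_prod f f ` parcs G"
    by blast
  define h where "h = \<lparr>iso_verts = f, iso_arcs = map_prod f f, iso_head = snd, iso_tail = fst\<rparr>"
  have "inj_on (map_prod f f) (pverts G \<times> pverts G)"
    using f(1) by (auto simp: inj_on_def)
  then have "inj_on (map_prod f f) (parcs G)"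
    by (rule inj_on_subset) (auto dest: in_arcsD1 in_arcsD2)
  then have "pre_digraph.digraph_isomorphism (with_proj G) h"
    using f(1) wf_digraph_axioms by (simp add: pre_digraph.digraph_isomorphism_def h_def)
  moreover have "with_proj H = app_iso h (with_proj G)"
    using f by (simp add: app_iso_def h_def with_proj_def)
  ultimately show "digraph_iso (with_proj G) (with_proj H)"
    unfolding digraph_iso_def by blast
qed

text \<open>Centre goes to centre and triangle to triangle; any bijection between the leaves
  completes the map.\<close>

lemma star_with_triangle_digraph_iso:
  assumes "star_with_triangle V c a b" "star_with_triangle V' c' a' b'" "card V = card V'"
  shows "digraph_iso (with_proj (star_plus_edge_at V c a b)) (with_proj (star_plus_edge_at V' c' a' b'))"
proof -
  interpret A: star_with_triangle V c a b by fact
  interpret B: star_with_triangle V' c' a' b' by fact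
  have "card (V - {c, a, b}) = card (V' - {c', a', b'})"
    using A.finite A.in_V A.distinct B.finite B.in_V B.distinct assms(3)
    by (simp add: card_Diff_subset)
  then obtain g where g: "bij_betw g (V - {c, a, b}) (V' - {c', a', b'})"
    using A.finite B.finite by (metis finite_Diff finite_same_card_bij)
  define f where "f u = (if u = c then c' else if u = a then a' else if u = b then b' else g u)" for u
  have f: "f c = c'" "f a = a'" "f b = b'" using A.distinct by (auto simp: f_def)
  have "bij_betw f (V - {c, a, b}) (V' - {c', a', b'})"
    using g by (rule bij_betw_cong[THEN iffD1, rotated]) (auto simp: f_def)
  moreover have "bij_betw f {c, a, b} {c', a', b'}"
    using A.distinct B.distinct by (auto simp: bij_betw_def f)
  ultimately have "bij_betw f ((V - {c, a, b}) \<union> {c, a, b}) ((V' - {c', a', b'}) \<union> {c', a', b'})"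
    by (rule bij_betw_combine) auto
  moreover have "(V - {c, a, b}) \<union> {c, a, b} = V" "(V' - {c', a', b'}) \<union> {c', a', b'} = V'"
    using A.in_V B.in_V by auto
  ultimately have bij: "bij_betw f V V'" by simp
  then have inj: "inj_on f V" and V': "V' = f ` V" by (auto simp: bij_betw_def)
  have "f ` (V - {c}) = V' - {c'}"
    using inj A.in_V by (simp add: inj_on_image_set_diff V' f)
  then have "parcs (star_plus_edge_at V' c' a' b') = map_prod f f ` parcs (star_plus_edge_at V c a b)"
    by (simp add: star_plus_edge_at_def image_Un map_prod_surj_on[OF refl refl] f)
  then show ?thesis
    unfolding digraph_iso_with_proj_iff[OF A.H.pair_wf_digraph]
    using inj V' by (intro exI[of _ f]) (simp add: star_plus_edge_at_def)
qed

lemma star_with_triangle_standard: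
  assumes "n \<ge> 3"
  shows "star_with_triangle {0..<n} 0 1 (2 :: nat)"
  using assms by unfold_locales auto

text \<open>Pulling 0, 1 and 2 back along the isomorphism gives an equality of graphs, so that
  \<open>gamma_H\<close> can be applied to \<open>G\<close> itself.\<close>

lemma star_with_triangle_of_digraph_iso:
  assumes "pair_graph G" "n \<ge> 3" "digraph_iso (with_proj G) (with_proj (star_plus_edge n))"
  obtains c a b where "star_with_triangle (pverts G) c a b" "G = star_plus_edge_at (pverts G) c a b"
proof -
  interpret pair_graph G by fact
  let ?V = "pverts G"
  obtain f where f: "inj_on f ?V" "f ` ?V = {0..<n}"
      "parcs (star_plus_edge n) = map_prod f f ` parcs G"
    using assms(3) unfolding digraph_iso_with_proj_iff[OF pair_wf_digraph]
    by (auto simp: star_plus_edge_def star_def)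
  have "0 \<in> f ` ?V" "1 \<in> f ` ?V" "2 \<in> f ` ?V" using assms(2) by (auto simp: f(2))
  then obtain c a b where abc: "c \<in> ?V" "f c = 0" "a \<in> ?V" "f a = 1" "b \<in> ?V" "f b = 2"
    by (metis imageE)
  have f_eq: "f u = 0 \<longleftrightarrow> u = c" "f u = 1 \<longleftrightarrow> u = a" "f u = 2 \<longleftrightarrow> u = b" if "u \<in> ?V" for u
    using inj_onD[OF f(1)] that abc by metis+
  have f_less: "f u < n" if "u \<in> ?V" for u
    using that f(2) by auto
  have arc: "(u, v) \<in> parcs G \<longleftrightarrow> u \<in> ?V \<and> v \<in> ?V \<and> (f u, f v) \<in> parcs (star_plus_edge n)" for u v
  proof
    assume "u \<in> ?V \<and> v \<in> ?V \<and> (f u, f v) \<in> parcs (star_plus_edge n)"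
    then obtain u' v' where "(u', v') \<in> parcs G" "f u = f u'" "f v = f v'" "u \<in> ?V" "v \<in> ?V"
      by (auto simp: f(3))
    then show "(u, v) \<in> parcs G"
      using inj_onD[OF f(1)] in_arcsD1 in_arcsD2 by metis
  qed (auto simp: f(3) dest: in_arcsD1 in_arcsD2)
  have arc_S: "(i, j) \<in> parcs (star_plus_edge n) \<longleftrightarrow>
      i = 0 \<and> j \<noteq> 0 \<or> i \<noteq> 0 \<and> j = 0 \<or> i = 1 \<and> j = 2 \<or> i = 2 \<and> j = 1"
    if "i < n" "j < n" for i j
    using that by (auto simp: star_plus_edge_def star_def)
  have "(u, v) \<in> parcs G \<longleftrightarrow> (u, v) \<in> parcs (star_plus_edge_at ?V c a b)" for u v
  proof (cases "u \<in> ?V \<and> v \<in> ?V")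
    case True
    then show ?thesis
      using abc by (auto simp: arc arc_S f_less f_eq star_plus_edge_at_def simp del: One_nat_def)
  next
    case False
    then show ?thesis
      using abc by (auto simp: arc star_plus_edge_at_def)
  qed
  then have "parcs G = parcs (star_plus_edge_at ?V c a b)" by auto
  then have "G = star_plus_edge_at ?V c a b"
    by (simp add: star_plus_edge_at_def)
  moreover have "star_with_triangle ?V c a b"
    using abc pair_finite_verts by unfold_locales auto
  ultimately show thesis by (rule that[rotated])
qed

section \<open>Comparison by maximum degree\<close>

context pair_graph
begin

lemma max_degree_attained:
  assumes "pverts G \<noteq> {}"
  obtains c where "c \<in> pverts G" "card (neighbours G c) = max_degree G"
proof -
  have "max_degree G \<in> (\<lambda>u. card (neighbours G u)) ` pverts G"
    unfolding max_degree_def out_degree_eq_card_neighbours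
    using assms pair_finite_verts by (intro Max_in) auto
  then show thesis using that by auto
qed

lemma neighbours_subset_Diff: "neighbours G u \<subseteq> pverts G - {u}"
  using neighbours_subset no_loops' by (fastforce simp: neighbours_def)

lemma dominating_vertex_in_triangle:
  assumes c: "c \<in> pverts G" "neighbours G c = pverts G - {c}" and "\<not> bipartite G"
  obtains a b where "star_with_triangle (pverts G) c a b"
    and "parcs (star_plus_edge_at (pverts G) c a b) \<subseteq> parcs G"
proof -
  let ?V = "pverts G"
  \<comment> \<open>Otherwise \<open>{c}\<close> and \<open>V - {c}\<close> form a bipartition.\<close>
  have "{c} \<union> (?V - {c}) = ?V" "{c} \<inter> (?V - {c}) = {}" using c by auto
  then obtain a b where ab: "(a, b) \<in> parcs G" "\<not> (a \<in> {c} \<and> b \<in> ?V - {c})" "\<not> (a \<in> ?V - {c} \<and> b \<in> {c})"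
    using assms(3) unfolding bipartite_def by (metis (no_types, lifting) case_prodI2)
  have V: "a \<in> ?V" "b \<in> ?V" and "a \<noteq> b"
    using ab(1) in_arcsD1 in_arcsD2 no_loops' by blast+
  \<comment> \<open>If one end were \<open>c\<close>, the other would lie in \<open>?V - {c}\<close>
    and the arc would respect the bipartition.\<close>
  then have "a \<noteq> c" "b \<noteq> c" using ab by auto
  then have "star_with_triangle ?V c a b"
    using V \<open>a \<noteq> b\<close> c pair_finite_verts by unfold_locales auto
  moreover have "(c, u) \<in> parcs G" if "u \<in> ?V - {c}" for u
    using that c by (auto simp: neighbours_def)
  then have "parcs (star_plus_edge_at ?V c a b) \<subseteq> parcs G"
    using ab(1) by (auto simp: star_plus_edge_at_def intro: arcs_symmetric)
  ultimately show thesis by (rule that)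
qed

text \<open>A rearrangement of \<open>D - m < d - t\<close>, the strict inequality between the two
  values of \<open>gamma\<close>.\<close>

lemma fixed_point_less_of_small_max_degree:
  assumes \<alpha>: "0 \<le> \<alpha>" "\<alpha> < 1" and n: "card (pverts G) \<ge> 4"
    and t: "centre_map \<alpha> (real (card (pverts G) - 1)) t = t"
    and small: "max_degree G < card (pverts G) - 1"
  shows "t < rho \<alpha> G + real (card (pverts G) - 1 - max_degree G)"
proof -
  define d where "d = real (card (pverts G) - 1)"
  define D where "D = real (max_degree G)"
  define m where "m = rho \<alpha> G"
  define k where "k = real (card (pverts G) - 1 - max_degree G)"
  have "pverts G \<noteq> {}" using n by auto
  then obtain c where c: "c \<in> pverts G" "card (neighbours G c) = max_degree G"
    by (rule max_degree_attained)
  have d: "d = D + k" "k \<ge> 1" "d \<ge> 3" using small n by (auto simp: d_def D_def k_def)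
  have t': "centre_map \<alpha> d t = t" using t by (simp add: d_def)
  have star: "D * (\<alpha> + \<alpha> * s\<^sup>2 + 2 * (1 - \<alpha>) * s) \<le> m * (1 + D * s\<^sup>2)" if "s \<ge> 0" for s
    using rho_star_bound[OF c(1), of \<alpha> s] \<alpha> that by (simp add: c D_def m_def)
  \<comment> \<open>The indicator vector of \<open>c\<close> and its neighbours; this rough bound
    secures m \<ge> 1 or m \<ge> D in the two cases.\<close>
  have avg: "2 * D \<le> m * (1 + D)" using star[of 1] by (simp add: algebra_simps)
  have "t < m + k"
  proof (cases "D \<ge> 2")
    case True
    have "m \<ge> 1"
    proof (rule ccontr)
      assume "\<not> m \<ge> 1"
      then have "m * (1 + D) < 1 * (1 + D)" using True by (intro mult_strict_right_mono) auto
      with avg have "2 * D < 1 * (1 + D)" by (rule le_less_trans)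
      then show False using True by simp
    qed
    \<comment> \<open>Solves the leaf equation \<alpha> s + (1 - \<alpha>) = m s of a star with
      eigenvalue \<open>m\<close>; with it the star bound becomes the hypothesis of
      \<open>centre_map_less_shifted\<close>.\<close>
    define s where "s = (1 - \<alpha>) / (m - \<alpha>)"
    have s: "s \<ge> 0" "s * (m - \<alpha>) = 1 - \<alpha>" using \<alpha> \<open>m \<ge> 1\<close> by (auto simp: s_def)
    then have "s\<^sup>2 * (m - \<alpha>) = (1 - \<alpha>) * s" by (simp add: power2_eq_square mult_ac)
    then have "D * (s\<^sup>2 * (m - \<alpha>)) = D * ((1 - \<alpha>) * s)" by simp
    then have "\<alpha> * D + D * ((1 - \<alpha>) * s) \<le> m"
      using star[OF s(1)] by (simp add: algebra_simps)
    then have "\<alpha> * D + (1 - \<alpha>)\<^sup>2 * (D / (m - \<alpha>)) \<le> m"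
      by (simp add: s_def power2_eq_square mult_ac)
    then have "centre_map \<alpha> (D + k) (m + k) < m + k"
      using \<alpha> True d \<open>m \<ge> 1\<close> by (intro centre_map_less_shifted) auto
    then show ?thesis
      using \<alpha> t' d \<open>m \<ge> 1\<close>
      by (intro centre_map_fixed_point_less[of \<alpha> d t]) auto
  next
    case False
    \<comment> \<open>For D \<le> 1 it suffices that m \<ge> D and t < d = D + k.\<close>
    then have "max_degree G = 0 \<or> max_degree G = 1" by (auto simp: D_def)
    then have "D = 0 \<or> D = 1" by (auto simp: D_def)
    then have "m \<ge> D" using avg by auto
    moreover have "t < d"
      using \<alpha> t' d centre_map_less[of \<alpha> d]
      by (intro centre_map_fixed_point_less[of \<alpha> d t]) auto
    ultimately show ?thesis using d by simp
  qed
  then show ?thesis by (simp add: m_def k_def)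
qed

end

theorem theorem4p3:
  fixes G :: "'a pair_pre_digraph" and n :: nat and \<alpha> :: real
  assumes "pair_graph G"
    and "card (pverts G) = n"
    and "n \<ge> 4"
    and "\<not> bipartite G"
    and "0 \<le> \<alpha>" and "\<alpha> < 1"
  shows "gamma \<alpha> G \<le> gamma \<alpha> (star_plus_edge n) \<and>
    (gamma \<alpha> G = gamma \<alpha> (star_plus_edge n) \<longleftrightarrow>
      digraph_iso (with_proj G) (with_proj (star_plus_edge n)))"
proof -
  interpret pair_graph G by fact
  let ?V = "pverts G" and ?S = "star_plus_edge n"
  let ?d = "real (n - 1)"
  interpret S: star_with_triangle "{0..<n}" 0 1 2
    using assms(3) by (intro star_with_triangle_standard) simp
  obtain t where t: "t \<ge> 2" "centre_map \<alpha> ?d t = t"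
    using centre_map_fixed_point[of \<alpha> ?d] assms by auto
  have gamma_S: "gamma \<alpha> ?S = ?d - t"
    using S.gamma_H[of \<alpha> t] assms t by (simp add: star_plus_edge_conv)
  have gamma_eq: "gamma \<alpha> G = gamma \<alpha> ?S" if iso: "digraph_iso (with_proj G) (with_proj ?S)"
  proof -
    obtain c a b where cab: "star_with_triangle ?V c a b" and G: "G = star_plus_edge_at ?V c a b"
      using star_with_triangle_of_digraph_iso[OF assms(1) _ iso] assms(3) by auto
    have "gamma \<alpha> G = ?d - t"
      using star_with_triangle.gamma_H[OF cab, of \<alpha> t] assms t by (simp flip: G)
    then show ?thesis by (simp add: gamma_S)
  qed
  \<comment> \<open>Together with \<open>gamma_eq\<close> this dichotomy gives both the inequality
    and the equality case.\<close>
  have "gamma \<alpha> G < gamma \<alpha> ?S \<or> digraph_iso (with_proj G) (with_proj ?S)"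
  proof (cases "max_degree G < n - 1")
    case True
    then have "t < rho \<alpha> G + real (n - 1 - max_degree G)"
      using fixed_point_less_of_small_max_degree[of \<alpha> t] assms t by simp
    then show ?thesis
      using True unfolding gamma_S by (simp add: gamma_def of_nat_diff)
  next
    case False
    have "?V \<noteq> {}" using assms(2,3) by auto
    then obtain c where c: "c \<in> ?V" "card (neighbours G c) = max_degree G"
      by (rule max_degree_attained)
    have "card (?V - {c}) = n - 1" using c(1) pair_finite_verts assms(2) by simp
    moreover have fin: "finite (?V - {c})" using pair_finite_verts by simp
    ultimately have max: "max_degree G = n - 1" and "card (neighbours G c) = card (?V - {c})"
      using card_mono[OF fin neighbours_subset_Diff] False c(2) by auto
    then have "neighbours G c = ?V - {c}"
      using card_subset_eq[OF fin neighbours_subset_Diff] by blast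
    then obtain a b where cab: "star_with_triangle ?V c a b"
      and sub: "parcs (star_plus_edge_at ?V c a b) \<subseteq> parcs G"
      using dominating_vertex_in_triangle[OF c(1) _ assms(4)] by blast
    interpret T: star_with_triangle ?V c a b by fact
    show ?thesis
    proof (cases "parcs (star_plus_edge_at ?V c a b) = parcs G")
      case True
      then have "star_plus_edge_at ?V c a b = G"
        by (simp add: star_plus_edge_at_def)
      then show ?thesis
        using star_with_triangle_digraph_iso[OF cab S.star_with_triangle_axioms] assms(2)
        by (simp add: star_plus_edge_conv)
    next
      case False
      then have "t < rho \<alpha> G"
        using T.rho_less_of_proper_supergraph[of \<alpha> t G] sub assms t by auto
      then show ?thesis unfolding gamma_S by (simp add: gamma_def max)
    qed
  qed
  then show ?thesis using gamma_eq by auto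
qed

end
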